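(* Let $G=(V,E)$ be a finite simple graph and let $g\in\{0,1,-1\}^E$ be a mixed-sign vector. If $\mathrm{supp}(g)$ is the edge set of a rooted (odd length) alternating cycle of length at least $5$ in $G$, then $g$ is a circuit of the rank inequality system of $G$.
   Context: A vector is mixed-sign if it has at least one positive and at least one negative entry. A rooted alternating cycle (with respect to $g$) is a cycle of odd length with edge set $\mathrm{supp}(g)$ having exactly one vertex (the root) whose two incident cycle edges $e,f$ satisfy $g(e)=g(f)$, while at every other vertex of the cycle the two incident cycle edges $e,f$ satisfy $g(e)=-g(f)$. The rank inequality system of $G$ is $\sum_{e\in E(G[U])}x(e)\le |U|-1$ for all $\emptyset\neq U\subseteq V$, where $G[U]$ is the subgraph induced by $U$; let $B$ be its constraint matrix, so $(Bx)_U=\sum_{e\in E(G[U])}x(e)$. A circuit of the system is a vector $g\in\mathbb{R}^E\setminus\{0\}$ with coprime integer components such that the support of $Bg$ is inclusion-minimal among the supports of $\{Bx : x\in\mathbb{R}^E\setminus\{0\}\}$. *)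

theory Defs
  imports Complex_Main "HOL-Library.FuncSet"
begin

definition finite_simple_graph :: "'v set \<Rightarrow> 'v set set \<Rightarrow> bool" where
  "finite_simple_graph V E \<longleftrightarrow> finite V \<and> (\<forall>e\<in>E. e \<subseteq> V \<and> card e = 2)"

definition induced_edges :: "'v set set \<Rightarrow> 'v set \<Rightarrow> 'v set set" where
  "induced_edges E U = {e \<in> E. e \<subseteq> U}"

text \<open>A cycle is given by the list of its vertices in cyclic order; its length is the
  length of the list.\<close>

definition cycle_edges :: "'v list \<Rightarrow> 'v set set" where
  "cycle_edges c = {{c ! i, c ! (Suc i mod length c)} | i. i < length c}"

definition is_cycle :: "'v set \<Rightarrow> 'v set set \<Rightarrow> 'v list \<Rightarrow> bool" where
  "is_cycle V E c \<longleftrightarrow>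
     3 \<le> length c \<and> distinct c \<and> set c \<subseteq> V \<and> cycle_edges c \<subseteq> E"

text \<open>A real vector indexed by \<open>J\<close> is an element of \<open>J \<rightarrow>\<^sub>E UNIV\<close>; its zero vector
  is \<open>\<lambda>j\<in>J. 0\<close>.\<close>

definition supp :: "'j set \<Rightarrow> ('j \<Rightarrow> real) \<Rightarrow> 'j set" where
  "supp J x = {j \<in> J. x j \<noteq> 0}"

definition mixed_sign :: "'j set \<Rightarrow> ('j \<Rightarrow> real) \<Rightarrow> bool" where
  "mixed_sign J x \<longleftrightarrow> (\<exists>j\<in>J. x j > 0) \<and> (\<exists>j\<in>J. x j < 0)"

definition mat_vec :: "'i set \<Rightarrow> 'j set \<Rightarrow> ('i \<Rightarrow> 'j \<Rightarrow> real) \<Rightarrow> ('j \<Rightarrow> real) \<Rightarrow> 'i \<Rightarrow> real" where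
  "mat_vec I J B x = (\<lambda>i\<in>I. \<Sum>j\<in>J. B i j * x j)"

text \<open>Coprimality is that of the components taken together, not pairwise.\<close>

definition coprime_integral :: "'j set \<Rightarrow> ('j \<Rightarrow> real) \<Rightarrow> bool" where
  "coprime_integral J x \<longleftrightarrow>
     (\<exists>z :: 'j \<Rightarrow> int. (\<forall>j\<in>J. x j = of_int (z j)) \<and> Gcd (z ` J) = 1)"

text \<open>Circuits of a system \<open>B x \<le> d\<close> with rows \<open>I\<close> and columns \<open>J\<close>; they do not depend on
  the right-hand side \<open>d\<close>.\<close>

definition circuit :: "'i set \<Rightarrow> 'j set \<Rightarrow> ('i \<Rightarrow> 'j \<Rightarrow> real) \<Rightarrow> ('j \<Rightarrow> real) \<Rightarrow> bool" where
  "circuit I J B g \<longleftrightarrow>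
     g \<in> (J \<rightarrow>\<^sub>E UNIV) - {\<lambda>j\<in>J. 0} \<and>
     coprime_integral J g \<and>
     \<not> (\<exists>x \<in> (J \<rightarrow>\<^sub>E UNIV) - {\<lambda>j\<in>J. 0}.
          supp I (mat_vec I J B x) \<subset> supp I (mat_vec I J B g))"

text \<open>The inequalities \<open>(\<Sum>e \<in> induced_edges E U. x e) \<le> card U - 1\<close>, one for each nonempty
  \<open>U \<subseteq> V\<close>.\<close>

definition rank_rows :: "'v set \<Rightarrow> 'v set set" where
  "rank_rows V = {U. U \<subseteq> V \<and> U \<noteq> {}}"

definition rank_matrix :: "'v set set \<Rightarrow> 'v set \<Rightarrow> 'v set \<Rightarrow> real" where
  "rank_matrix E U e = (if e \<in> induced_edges E U then 1 else 0)"

lemma mat_vec_rank_matrix: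
  assumes "finite_simple_graph V E" "U \<in> rank_rows V"
  shows "mat_vec (rank_rows V) E (rank_matrix E) x U = (\<Sum>e\<in>induced_edges E U. x e)"
proof -
  have "E \<subseteq> Pow V" "finite V"
    using assms(1) by (auto simp: finite_simple_graph_def)
  then have "finite E"
    by (meson finite_Pow_iff finite_subset)
  then have "(\<Sum>e\<in>E. rank_matrix E U e * x e) = (\<Sum>e\<in>induced_edges E U. x e)"
    by (intro sum.mono_neutral_cong_right) (auto simp: rank_matrix_def induced_edges_def)
  then show ?thesis
    using assms(2) by (simp add: mat_vec_def)
qed

definition rank_circuit :: "'v set \<Rightarrow> 'v set set \<Rightarrow> ('v set \<Rightarrow> real) \<Rightarrow> bool" where
  "rank_circuit V E g \<longleftrightarrow> circuit (rank_rows V) E (rank_matrix E) g"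

text \<open>Every vertex of a cycle lies on exactly two cycle edges, so the quantifiers over
  \<open>e\<close> and \<open>f\<close> below range over this one pair.\<close>

definition equal_at :: "('v set \<Rightarrow> real) \<Rightarrow> 'v list \<Rightarrow> 'v \<Rightarrow> bool" where
  "equal_at g c v \<longleftrightarrow>
     (\<forall>e\<in>cycle_edges c. \<forall>f\<in>cycle_edges c. e \<noteq> f \<and> v \<in> e \<and> v \<in> f \<longrightarrow> g e = g f)"

definition opposite_at :: "('v set \<Rightarrow> real) \<Rightarrow> 'v list \<Rightarrow> 'v \<Rightarrow> bool" where
  "opposite_at g c v \<longleftrightarrow>
     (\<forall>e\<in>cycle_edges c. \<forall>f\<in>cycle_edges c. e \<noteq> f \<and> v \<in> e \<and> v \<in> f \<longrightarrow> g e = - g f)"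

definition rooted_alternating_cycle ::
    "'v set \<Rightarrow> 'v set set \<Rightarrow> ('v set \<Rightarrow> real) \<Rightarrow> 'v list \<Rightarrow> bool" where
  "rooted_alternating_cycle V E g c \<longleftrightarrow>
     is_cycle V E c \<and> odd (length c) \<and> cycle_edges c = supp E g \<and>
     (\<exists>!r. r \<in> set c \<and> equal_at g c r) \<and>
     (\<forall>v\<in>set c. \<not> equal_at g c v \<longrightarrow> opposite_at g c v)"

end

theory Submission
  imports Defs
begin

text \<open>The vector \<open>g\<close> is support-minimal because the rows \<open>U\<close> on which \<open>B g\<close> vanishes already
  determine it up to a scalar: whenever \<open>B x\<close> vanishes on all those rows, \<open>x\<close> is a multiple of \<open>g\<close>
  (\<open>circuit_if_unique_up_to_scaling\<close>).  Two kinds of rows suffice.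

  If \<open>e\<close> is an edge outside \<open>supp g\<close>, then the row of its two endpoints gives \<open>x e = 0\<close>, so \<open>x\<close>
  lives on the cycle too.  If \<open>e\<close> and \<open>f\<close> are consecutive edges of the cycle, meeting at a vertex
  other than the root, then \<open>g e + g f = 0\<close>.  The three vertices of \<open>e \<union> f\<close> span no further cycle
  edge, as the cycle is not a triangle (\<open>induced_cycle_edges_three_consecutive\<close>).  Chords in \<open>G\<close>
  do no harm, as both \<open>g\<close> and \<open>x\<close> vanish on them.  Hence the row of these three vertices
  gives \<open>x e + x f = 0\<close>.  Walking once around the cycle from the root, \<open>x\<close> therefore changes sign
  exactly where \<open>g\<close> does, and the ratio \<open>x e / g e\<close> never changes.  The root itself, where the
  two edges have equal signs and the row of the three vertices says nothing about \<open>x\<close>, is only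
  the start and the end of the walk.\<close>

section \<open>Circuits from uniqueness up to scaling\<close>

lemma mat_vec_scale:
  assumes "\<And>j. j \<in> J \<Longrightarrow> x j = t * g j"
  shows "mat_vec I J B x i = (if i \<in> I then t * mat_vec I J B g i else undefined)"
  using assms by (simp add: mat_vec_def sum_distrib_left mult.left_commute)

text \<open>By the uniqueness, a nonzero \<open>x\<close> whose image has support inside that of \<open>B g\<close> is a
  nonzero multiple of \<open>g\<close>, so its image has the same support as \<open>B g\<close>.\<close>

lemma circuit_if_unique_up_to_scaling:
  assumes g: "g \<in> (J \<rightarrow>\<^sub>E UNIV) - {\<lambda>j\<in>J. 0}"
    and "coprime_integral J g"
    and unique: "\<And>x. supp I (mat_vec I J B x) \<subseteq> supp I (mat_vec I J B g) \<Longrightarrow>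
      \<exists>t. \<forall>j\<in>J. x j = t * g j"
  shows "circuit I J B g"
proof -
  have False
    if x: "x \<in> (J \<rightarrow>\<^sub>E UNIV) - {\<lambda>j\<in>J. 0}"
      and less: "supp I (mat_vec I J B x) \<subset> supp I (mat_vec I J B g)" for x
  proof -
    obtain t where t: "\<forall>j\<in>J. x j = t * g j"
      using unique less by blast
    have "t \<noteq> 0"
    proof
      assume "t = 0"
      then have "x = (\<lambda>j\<in>J. 0)"
        using x t by (intro extensionalityI[of _ J]) (auto simp: PiE_iff)
      then show False
        using x by simp
    qed
    then have "supp I (mat_vec I J B x) = supp I (mat_vec I J B g)"
      using mat_vec_scale[of J x t g I B] t by (auto simp: supp_def)
    then show False
      using less by simp
  qed
  then show ?thesis
    using assms(1,2) unfolding circuit_def by blast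
qed

lemma coprime_integral_sign_vector:
  assumes "g \<in> J \<rightarrow>\<^sub>E {0, 1, -1}" and "j \<in> J" and "g j \<noteq> 0"
  shows "coprime_integral J g"
proof -
  define z :: "_ \<Rightarrow> int" where "z i = (if g i = 0 then 0 else if g i = 1 then 1 else -1)" for i
  have range: "g i = 0 \<or> g i = 1 \<or> g i = -1" if "i \<in> J" for i
    using assms(1) that by (auto simp: PiE_iff)
  have "\<forall>i\<in>J. g i = of_int (z i)"
    using range by (force simp: z_def)
  moreover have "z j dvd 1"
    using range[OF assms(2)] assms(3) by (auto simp: z_def)
  then have "Gcd (z ` J) dvd 1"
    using assms(2) by (meson Gcd_dvd dvd_trans imageI)
  then have "Gcd (z ` J) = 1"
    using Gcd_int_greater_eq_0[of "z ` J"] by auto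
  ultimately show ?thesis
    unfolding coprime_integral_def by blast
qed

section \<open>Consecutive edges of a cycle\<close>

text \<open>The index is read modulo the length, so that the successor of an edge on the cycle has
  the successor index without exception.\<close>

definition cycle_edge :: "'v list \<Rightarrow> nat \<Rightarrow> 'v set" where
  "cycle_edge c i = {c ! (i mod length c), c ! (Suc i mod length c)}"

lemma cycle_edges_eq: "cycle_edges c = cycle_edge c ` {..<length c}"
  unfolding cycle_edges_def cycle_edge_def by force

lemma cycle_edge_mod: "cycle_edge c (i mod length c) = cycle_edge c i"
  by (simp add: cycle_edge_def mod_Suc_eq)

lemma cycle_edge_in:
  assumes "c \<noteq> []"
  shows "cycle_edge c i \<in> cycle_edges c"
  using assms cycle_edge_mod[of c i]
  by (metis cycle_edges_eq imageI length_greater_0_conv lessThan_iff mod_less_divisor)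

text \<open>The last of three consecutive positions is followed by a fourth one, which is new as \<open>n \<ge> 4\<close>.\<close>

lemma successor_within_three_consecutive:
  fixes i j n :: nat
  assumes "4 \<le> n" "i < n" "j < n"
    and "j \<in> {i, Suc i mod n, Suc (Suc i) mod n}"
    and "Suc j mod n \<in> {i, Suc i mod n, Suc (Suc i) mod n}"
  shows "j = i \<or> j = Suc i mod n"
  using assms by (auto simp: mod_Suc split: if_splits)

lemma consecutive_cycle_edges_distinct:
  assumes "distinct c" "3 \<le> length c"
  shows "cycle_edge c i \<noteq> cycle_edge c (Suc i)"
proof -
  define k where "k = i mod length c"
  have k: "k < length c"
    using assms unfolding k_def by (intro mod_less_divisor) linarith
  have Suc_k: "Suc i mod length c = Suc k mod length c"
    "Suc (Suc i) mod length c = Suc (Suc k mod length c) mod length c"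
    by (simp_all add: k_def mod_simps)
  have less: "Suc k mod length c < length c"
    "Suc (Suc k mod length c) mod length c < length c"
    using assms by (auto intro!: mod_less_divisor)
  have "k \<noteq> Suc k mod length c" "k \<noteq> Suc (Suc k mod length c) mod length c"
    using assms k by (auto simp: mod_Suc)
  then have "c ! k \<notin> cycle_edge c (Suc i)"
    using assms k less by (simp add: cycle_edge_def Suc_k nth_eq_iff_index_eq)
  moreover have "c ! k \<in> cycle_edge c i"
    by (simp add: cycle_edge_def k_def)
  ultimately show ?thesis
    by blast
qed

text \<open>This fails for a triangle, whose three vertices span a third cycle edge.\<close>

lemma induced_cycle_edges_three_consecutive:
  assumes "distinct c" "4 \<le> length c"
  shows "induced_edges (cycle_edges c) (cycle_edge c i \<union> cycle_edge c (Suc i)) =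
    {cycle_edge c i, cycle_edge c (Suc i)}"
proof -
  define n where "n = length c"
  define k where "k = i mod n"
  have n: "4 \<le> n" "0 < n" "k < n"
    using assms by (auto simp: n_def k_def intro!: mod_less_divisor)
  have edge_k: "cycle_edge c i = cycle_edge c k"
    "cycle_edge c (Suc i) = cycle_edge c (Suc k mod n)"
    "cycle_edge c k = {c ! k, c ! (Suc k mod n)}"
    "cycle_edge c (Suc k mod n) = {c ! (Suc k mod n), c ! (Suc (Suc k) mod n)}"
    using n by (simp_all add: cycle_edge_def k_def n_def mod_simps)
  have "cycle_edge c j \<in> {cycle_edge c k, cycle_edge c (Suc k mod n)}"
    if j: "j < n" and sub: "cycle_edge c j \<subseteq> cycle_edge c k \<union> cycle_edge c (Suc k mod n)" for j
  proof -
    have nth: "l \<in> {k, Suc k mod n, Suc (Suc k) mod n}"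
      if "l < n" "c ! l \<in> cycle_edge c k \<union> cycle_edge c (Suc k mod n)" for l
      using that assms(1) n by (auto simp: edge_k[unfolded n_def] nth_eq_iff_index_eq n_def)
    have "j \<in> {k, Suc k mod n, Suc (Suc k) mod n}"
      "Suc j mod n \<in> {k, Suc k mod n, Suc (Suc k) mod n}"
      using nth[of j] nth[of "Suc j mod n"] sub j n by (auto simp: cycle_edge_def n_def)
    then show ?thesis
      using successor_within_three_consecutive[of n k j] n j by auto
  qed
  moreover have "c \<noteq> []"
    using assms by auto
  ultimately show ?thesis
    using cycle_edge_in[of c]
    by (auto simp: induced_edges_def edge_k(1,2) cycle_edges_eq n_def)
qed

section \<open>Vectors supported on a cycle\<close>

lemma sum_two_consecutive_edges:
  assumes "finite E" "distinct c" "4 \<le> length c" "cycle_edges c \<subseteq> E"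
    and zero: "\<And>e. e \<in> E - cycle_edges c \<Longrightarrow> x e = 0"
  shows "(\<Sum>e\<in>induced_edges E (cycle_edge c i \<union> cycle_edge c (Suc i)). x e) =
    x (cycle_edge c i) + x (cycle_edge c (Suc i))"
proof -
  let ?U = "cycle_edge c i \<union> cycle_edge c (Suc i)"
  have "(\<Sum>e\<in>induced_edges E ?U. x e) = (\<Sum>e\<in>induced_edges (cycle_edges c) ?U. x e)"
    using assms by (intro sum.mono_neutral_right) (auto simp: induced_edges_def)
  also have "\<dots> = x (cycle_edge c i) + x (cycle_edge c (Suc i))"
    using assms consecutive_cycle_edges_distinct[of c i]
    by (simp add: induced_cycle_edges_three_consecutive)
  finally show ?thesis .
qed

text \<open>Starting at the edge that leaves position \<open>r\<close>, the walk meets every edge before it comes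
  back to \<open>r\<close>, so no step through the vertex at position \<open>r\<close> is ever made.\<close>

lemma constant_on_cycle_edges_if_constant_off_root:
  assumes r: "r < length c"
    and step: "\<And>i. Suc i mod length c \<noteq> r \<Longrightarrow>
      h (cycle_edge c (Suc i)) = h (cycle_edge c i)"
    and e: "e \<in> cycle_edges c"
  shows "h e = h (cycle_edge c r)"
proof -
  let ?n = "length c"
  have walk: "h (cycle_edge c (r + d)) = h (cycle_edge c r)" if "d < ?n" for d
    using that
  proof (induction d)
    case 0
    then show ?case by simp
  next
    case (Suc d)
    have "Suc (r + d) mod ?n \<noteq> r"
      using r Suc.prems by (auto simp: mod_if split: if_splits)
    then show ?case
      using step[of "r + d"] Suc by simp
  qed
  obtain i where i: "i < ?n" "e = cycle_edge c i"
    using e by (auto simp: cycle_edges_eq)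
  have "\<exists>d<?n. (r + d) mod ?n = i"
  proof (cases "r \<le> i")
    case True
    then show ?thesis
      using i by (intro exI[of _ "i - r"]) auto
  next
    case False
    then show ?thesis
      using i r by (intro exI[of _ "i + ?n - r"]) auto
  qed
  then show ?thesis
    using walk i(2) cycle_edge_mod by metis
qed

section \<open>Rooted alternating cycles give circuits\<close>

lemma zero_off_support_if_rank_support_subset:
  assumes G: "finite_simple_graph V E"
    and sub: "supp (rank_rows V) (mat_vec (rank_rows V) E (rank_matrix E) x) \<subseteq>
      supp (rank_rows V) (mat_vec (rank_rows V) E (rank_matrix E) g)"
    and e: "e \<in> E - supp E g"
  shows "x e = 0"
proof -
  have pair: "f \<subseteq> V \<and> card f = 2" if "f \<in> E" for f
    using G that by (auto simp: finite_simple_graph_def)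
  have row: "e \<in> rank_rows V"
    using pair[of e] e by (auto simp: rank_rows_def)
  \<comment> \<open>Edges all have two elements, so none lies properly inside another.\<close>
  have "induced_edges E e = {e}"
  proof -
    have "f = e" if "f \<in> E" "f \<subseteq> e" for f
    proof (rule card_subset_eq)
      show "finite e"
        using pair[of e] e by (intro card_ge_0_finite) simp
      show "card f = card e"
        using pair that e by simp
    qed (fact that)
    then show ?thesis
      using e by (auto simp: induced_edges_def)
  qed
  then have row_value: "mat_vec (rank_rows V) E (rank_matrix E) y e = y e" for y
    by (simp add: mat_vec_rank_matrix[OF G row])
  show ?thesis
    using sub row e by (auto simp: supp_def row_value)
qed

theorem lemma4p6:
  fixes V :: "'v set" and E :: "'v set set" and g :: "'v set \<Rightarrow> real" and c :: "'v list"
  assumes "finite_simple_graph V E"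
    and "g \<in> E \<rightarrow>\<^sub>E {0, 1, -1}"
    and "mixed_sign E g"
    and "rooted_alternating_cycle V E g c"
    and "length c \<ge> 5"
  shows "rank_circuit V E g"
proof -
  let ?B = "mat_vec (rank_rows V) E (rank_matrix E)"
  have cyc: "distinct c" "set c \<subseteq> V" "cycle_edges c \<subseteq> E" "cycle_edges c = supp E g"
    and alt: "\<And>v. v \<in> set c \<Longrightarrow> \<not> equal_at g c v \<Longrightarrow> opposite_at g c v"
    using assms(4) by (auto simp: rooted_alternating_cycle_def is_cycle_def)
  have finite_E: "finite E"
    using assms(1) finite_subset[of E "Pow V"] by (auto simp: finite_simple_graph_def)
  obtain r where r: "r < length c"
    and root: "\<And>v. v \<in> set c \<Longrightarrow> equal_at g c v \<Longrightarrow> v = c ! r"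
    using assms(4) unfolding rooted_alternating_cycle_def by (metis in_set_conv_nth)
  have nonempty: "c \<noteq> []"
    using assms(5) by auto
  have g_opposite: "g (cycle_edge c i) = - g (cycle_edge c (Suc i))"
    if "Suc i mod length c \<noteq> r" for i
  proof -
    let ?v = "c ! (Suc i mod length c)"
    have less: "Suc i mod length c < length c"
      using nonempty by simp
    have "?v \<noteq> c ! r"
      using that less r cyc(1) by (simp add: nth_eq_iff_index_eq)
    then have "opposite_at g c ?v"
      using root alt less nth_mem by blast
    moreover have "cycle_edge c i \<noteq> cycle_edge c (Suc i)"
      using cyc(1) assms(5) by (intro consecutive_cycle_edges_distinct) auto
    ultimately show ?thesis
      using cycle_edge_in[OF nonempty] by (simp add: opposite_at_def cycle_edge_def)
  qed
  have unique: "\<exists>t. \<forall>e\<in>E. x e = t * g e"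
    if sub: "supp (rank_rows V) (?B x) \<subseteq> supp (rank_rows V) (?B g)" for x
  proof -
    have x_zero: "x e = 0" if "e \<in> E - cycle_edges c" for e
      using zero_off_support_if_rank_support_subset[OF assms(1) sub] that cyc(4) by simp
    have g_zero: "g e = 0" if "e \<in> E - cycle_edges c" for e
      using that cyc(4) by (simp add: supp_def)
    have x_opposite: "x (cycle_edge c i) = - x (cycle_edge c (Suc i))"
      if "Suc i mod length c \<noteq> r" for i
    proof -
      let ?U = "cycle_edge c i \<union> cycle_edge c (Suc i)"
      have row: "?U \<in> rank_rows V"
        using cyc(2) nonempty by (auto simp: rank_rows_def cycle_edge_def)
      have row_value: "?B y ?U = y (cycle_edge c i) + y (cycle_edge c (Suc i))"
        if "\<And>e. e \<in> E - cycle_edges c \<Longrightarrow> y e = 0" for y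
        using sum_two_consecutive_edges[OF finite_E cyc(1) _ cyc(3) that] assms(5)
        by (simp add: mat_vec_rank_matrix[OF assms(1) row])
      have "?B g ?U = 0"
        using row_value[OF g_zero] g_opposite[OF that] by simp
      then have "?B x ?U = 0"
        using sub row by (auto simp: supp_def)
      then show ?thesis
        using row_value[OF x_zero] by simp
    qed
    define t where "t = x (cycle_edge c r) / g (cycle_edge c r)"
    have ratio: "x e / g e = t" if "e \<in> cycle_edges c" for e
      using constant_on_cycle_edges_if_constant_off_root[of r c "\<lambda>e. x e / g e", OF r _ that]
        x_opposite g_opposite by (simp add: t_def)
    have "x e = t * g e" if "e \<in> E" for e
    proof (cases "e \<in> cycle_edges c")
      case True
      then have "g e \<noteq> 0"
        using cyc(4) by (auto simp: supp_def)
      then show ?thesis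
        using ratio[OF True] by (simp add: field_simps)
    next
      case False
      then show ?thesis
        using x_zero g_zero that by simp
    qed
    then show ?thesis by blast
  qed
  obtain e where e: "e \<in> E" "g e > 0"
    using assms(3) by (auto simp: mixed_sign_def)
  then have "g \<noteq> (\<lambda>j\<in>E. 0)"
    by auto
  then have "g \<in> (E \<rightarrow>\<^sub>E UNIV) - {\<lambda>j\<in>E. 0}"
    using assms(2) by (auto simp: PiE_iff)
  moreover have "coprime_integral E g"
    using coprime_integral_sign_vector[OF assms(2) e(1)] e(2) by simp
  ultimately show ?thesis
    unfolding rank_circuit_def by (rule circuit_if_unique_up_to_scaling) (rule unique)
qed

end
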